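(* The set $\mathfrak{H}$ is a sublattice of the lattice $\mathfrak{I}$ of all Schur idempotents; that is, if $\Phi,\Psi\in\mathfrak{H}$ then $\Phi\wedge\Psi\in\mathfrak{H}$ and $\Phi\vee\Psi\in\mathfrak{H}$.
   Context: $H$ is a separable Hilbert space, $\mathcal{B}(H)$ is the space of bounded linear operators on $H$ with the operator norm, and $\mathcal{D}\subseteq\mathcal{B}(H)$ is a fixed maximal abelian selfadjoint algebra (masa). For a subspace $\mathcal{X}\subseteq\mathcal{B}(H)$ and $T\in\mathcal{B}(H)$, put $\alpha(T,\mathcal{X})=\sup\{\inf_{X\in\mathcal{X}}\|T\xi-X\xi\| : \xi\in H,\ \|\xi\|=1\}$. A Schur multiplier is a weak* continuous $\mathcal{D}$-bimodule (linear) map on $\mathcal{B}(H)$; Schur multipliers commute under composition. A Schur idempotent is a Schur multiplier $\Phi$ with $\Phi\circ\Phi=\Phi$; $\mathfrak{I}$ is the set of all Schur idempotents. It is a lattice (in fact Boolean) under $\Phi\wedge\Psi=\Phi\Psi$, $\Phi\vee\Psi=\Phi+\Psi-\Phi\Psi$, with complementation $\Phi^\perp=\mathrm{id}-\Phi$. $\operatorname{Ran}\Phi$ denotes the range of $\Phi$. $\mathfrak{H}$ is the set of $\Phi\in\mathfrak{I}$ for which there is $\lambda>0$ with $\|\Phi^\perp(T)\|\leq\lambda\,\alpha(T,\operatorname{Ran}\Phi)$ for all $T\in\mathcal{B}(H)$. *)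

theory Defs
  imports "HOL-Analysis.Analysis"
begin

section \<open>Complex Hilbert spaces\<close>

class complex_vector = real_vector +
  fixes scaleC :: "complex \<Rightarrow> 'a \<Rightarrow> 'a"  (infixr \<open>*\<^sub>C\<close> 75)
  assumes scaleC_add_right: "c *\<^sub>C (x + y) = c *\<^sub>C x + c *\<^sub>C y"
    and scaleC_add_left: "(c + d) *\<^sub>C x = c *\<^sub>C x + d *\<^sub>C x"
    and scaleC_scaleC: "c *\<^sub>C d *\<^sub>C x = (c * d) *\<^sub>C x"
    and scaleC_one: "1 *\<^sub>C x = x"
    and scaleC_of_real: "complex_of_real r *\<^sub>C x = r *\<^sub>R x"

global_interpretation complex_vector:
  vector_space "scaleC :: complex \<Rightarrow> 'a \<Rightarrow> 'a::complex_vector"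
  by unfold_locales (simp_all add: scaleC_add_right scaleC_add_left scaleC_scaleC scaleC_one)

text \<open>
  The complex inner product is linear in the first argument.  Its real part is the real inner
  product of the underlying real space, so the norm, and with it completeness, comes from
  \<^class>\<open>real_inner\<close>: \<open>norm x\<close> is the square root of \<open>cinner x x\<close>.
\<close>

class chilbert_space = complex_vector + real_inner + complete_space +
  fixes cinner :: "'a \<Rightarrow> 'a \<Rightarrow> complex"
  assumes cinner_commute: "cinner x y = cnj (cinner y x)"
    and cinner_add_left: "cinner (x + y) z = cinner x z + cinner y z"
    and cinner_scaleC_left: "cinner (c *\<^sub>C x) y = c * cinner x y"
    and Re_cinner: "Re (cinner x y) = inner x y"

lemma cinner_self: "cinner x x = complex_of_real ((norm x)\<^sup>2)"
proof -
  have "Im (cinner x x) = 0"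
    using arg_cong[OF cinner_commute[of x x], of Im] by simp
  then show ?thesis
    by (simp add: complex_eq_iff Re_cinner power2_norm_eq_inner)
qed

lemma norm_scaleC: "norm (c *\<^sub>C x) = cmod c * norm (x :: 'a::chilbert_space)"
proof -
  have "cinner (c *\<^sub>C x) (c *\<^sub>C x) = c * cnj (c * cinner x x)"
    by (metis cinner_commute cinner_scaleC_left)
  also have "\<dots> = (c * cnj c) * complex_of_real ((norm x)\<^sup>2)"
    by (simp add: cinner_self)
  also have "\<dots> = complex_of_real ((cmod c * norm x)\<^sup>2)"
    by (simp only: complex_norm_square[symmetric] of_real_mult[symmetric] power_mult_distrib)
  finally have "(norm (c *\<^sub>C x))\<^sup>2 = (cmod c * norm x)\<^sup>2"
    by (simp only: cinner_self of_real_eq_iff)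
  then show ?thesis
    by (simp add: power2_eq_iff_nonneg)
qed

lemma bounded_linear_scaleC: "bounded_linear (\<lambda>x :: 'a::chilbert_space. c *\<^sub>C x)"
proof (rule bounded_linear_intro[where K = "cmod c"])
  fix x y :: 'a and r :: real
  show "c *\<^sub>C (x + y) = c *\<^sub>C x + c *\<^sub>C y"
    by (rule scaleC_add_right)
  show "c *\<^sub>C r *\<^sub>R x = r *\<^sub>R c *\<^sub>C x"
    by (simp add: scaleC_of_real[symmetric] scaleC_scaleC mult.commute)
  show "norm (c *\<^sub>C x) \<le> norm x * cmod c"
    by (simp add: norm_scaleC mult.commute)
qed

instantiation complex :: chilbert_space
begin

definition scaleC_complex :: "complex \<Rightarrow> complex \<Rightarrow> complex"
  where "scaleC_complex c x = c * x"

definition cinner_complex :: "complex \<Rightarrow> complex \<Rightarrow> complex"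
  where "cinner_complex x y = x * cnj y"

instance
  by standard
    (simp_all add: scaleC_complex_def cinner_complex_def algebra_simps scaleR_conv_of_real
      inner_complex_def)

end


section \<open>The space $\mathcal B(H)$\<close>

typedef (overloaded) 'a bop =
  "{T :: 'a::chilbert_space \<Rightarrow> 'a. bounded_linear T \<and> (\<forall>c x. T (c *\<^sub>C x) = c *\<^sub>C T x)}"
  morphisms bop_apply Bop
  by (rule exI[of _ "\<lambda>x. 0"]) auto

declare [[coercion "bop_apply :: 'a::chilbert_space bop \<Rightarrow> 'a \<Rightarrow> 'a"]]

setup_lifting type_definition_bop

lemma bop_eqI: "(\<And>x. bop_apply S x = bop_apply T x) \<Longrightarrow> S = T"
  by transfer auto

lift_definition bop_compose :: "'a::chilbert_space bop \<Rightarrow> 'a bop \<Rightarrow> 'a bop"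
  (infixl \<open>o\<^sub>B\<close> 67) is "\<lambda>S T x. S (T x)"
  by (auto intro: bounded_linear_compose)

instantiation bop :: (chilbert_space) real_normed_vector
begin

lift_definition norm_bop :: "'a bop \<Rightarrow> real" is onorm .

lift_definition zero_bop :: "'a bop" is "\<lambda>x. 0"
  by auto

lift_definition plus_bop :: "'a bop \<Rightarrow> 'a bop \<Rightarrow> 'a bop" is "\<lambda>S T x. S x + T x"
  by (auto intro: bounded_linear_add simp: scaleC_add_right)

lift_definition minus_bop :: "'a bop \<Rightarrow> 'a bop \<Rightarrow> 'a bop" is "\<lambda>S T x. S x - T x"
  by (auto intro: bounded_linear_sub simp: complex_vector.scale_right_diff_distrib)

lift_definition uminus_bop :: "'a bop \<Rightarrow> 'a bop" is "\<lambda>T x. - T x"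
  by (auto intro: bounded_linear_minus)

lift_definition scaleR_bop :: "real \<Rightarrow> 'a bop \<Rightarrow> 'a bop" is "\<lambda>r T x. r *\<^sub>R T x"
  by (auto intro: bounded_linear_compose[OF bounded_linear_scaleR_right])
    (simp add: scaleC_of_real[symmetric] scaleC_scaleC mult.commute)

definition dist_bop :: "'a bop \<Rightarrow> 'a bop \<Rightarrow> real"
  where "dist_bop S T = norm (S - T)"

definition sgn_bop :: "'a bop \<Rightarrow> 'a bop"
  where "sgn_bop T = inverse (norm T) *\<^sub>R T"

definition uniformity_bop :: "('a bop \<times> 'a bop) filter"
  where [code del]: "uniformity_bop = (INF e\<in>{0<..}. principal {(S, T). dist S T < e})"

definition open_bop :: "'a bop set \<Rightarrow> bool"
  where [code del]: "open_bop U = (\<forall>S\<in>U. \<forall>\<^sub>F (S', T) in uniformity. S' = S \<longrightarrow> T \<in> U)"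

instance
  apply standard
  unfolding dist_bop_def open_bop_def sgn_bop_def uniformity_bop_def
  apply (rule refl | (transfer, force simp: onorm_triangle onorm_scaleR onorm_eq_0 algebra_simps))+
  done

end

instantiation bop :: (chilbert_space) complex_vector
begin

lift_definition scaleC_bop :: "complex \<Rightarrow> 'a bop \<Rightarrow> 'a bop" is "\<lambda>c T x. c *\<^sub>C T x"
  by (auto intro: bounded_linear_compose[OF bounded_linear_scaleC]
      simp: scaleC_scaleC mult.commute)

instance
  by standard (transfer, simp add: scaleC_add_right scaleC_add_left scaleC_scaleC scaleC_one
      scaleC_of_real)+

end


section \<open>Masas\<close>

text \<open>
  \<open>is_adjoint S T\<close> says that \<open>S\<close> is the Hilbert space adjoint of \<open>T\<close> (which is unique).
\<close>

definition is_adjoint :: "'a::chilbert_space bop \<Rightarrow> 'a bop \<Rightarrow> bool"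
  where "is_adjoint S T \<longleftrightarrow> (\<forall>x y. cinner (T x) y = cinner x (S y))"

definition abelian_selfadjoint_algebra :: "'a::chilbert_space bop set \<Rightarrow> bool"
  where "abelian_selfadjoint_algebra \<D> \<longleftrightarrow>
    complex_vector.subspace \<D> \<and>
    (\<forall>A\<in>\<D>. \<forall>B\<in>\<D>. A o\<^sub>B B \<in> \<D>) \<and>
    (\<forall>A\<in>\<D>. \<forall>B\<in>\<D>. A o\<^sub>B B = B o\<^sub>B A) \<and>
    (\<forall>A\<in>\<D>. \<exists>S\<in>\<D>. is_adjoint S A)"

definition masa :: "'a::chilbert_space bop set \<Rightarrow> bool"
  where "masa \<D> \<longleftrightarrow> abelian_selfadjoint_algebra \<D> \<and>
    (\<forall>\<E>. abelian_selfadjoint_algebra \<E> \<and> \<D> \<subseteq> \<E> \<longrightarrow> \<E> = \<D>)"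


section \<open>The weak* topology\<close>

text \<open>
  The predual of $\mathcal B(H)$ is the space of trace class operators.  Every trace class
  operator has the form \<open>\<Sum>n. x n \<otimes> (y n)\<^sup>*\<close> with square-summable \<open>x\<close> and \<open>y\<close>, and it acts on
  $\mathcal B(H)$ by \<open>T \<mapsto> tr (T S) = (\<Sum>n. \<langle>T (x n), y n\<rangle>)\<close>.
\<close>

definition weak_star_functionals :: "('a::chilbert_space bop \<Rightarrow> complex) set"
  where "weak_star_functionals = {\<omega>. \<exists>x y :: nat \<Rightarrow> 'a.
    summable (\<lambda>n. (norm (x n))\<^sup>2) \<and> summable (\<lambda>n. (norm (y n))\<^sup>2) \<and>
    \<omega> = (\<lambda>T :: 'a bop. \<Sum>n. cinner (T (x n)) (y n))}"

definition weak_star_topology :: "'a::chilbert_space bop topology"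
  where "weak_star_topology =
    topology_generated_by {\<omega> -` U | \<omega> U. \<omega> \<in> weak_star_functionals \<and> open U}"


section \<open>Schur idempotents\<close>

definition bimodule_map :: "'a::chilbert_space bop set \<Rightarrow> ('a bop \<Rightarrow> 'a bop) \<Rightarrow> bool"
  where "bimodule_map \<D> \<Phi> \<longleftrightarrow> Vector_Spaces.linear scaleC scaleC \<Phi> \<and>
    (\<forall>A\<in>\<D>. \<forall>T. \<Phi> (A o\<^sub>B T) = A o\<^sub>B \<Phi> T \<and> \<Phi> (T o\<^sub>B A) = \<Phi> T o\<^sub>B A)"

definition schur_multiplier :: "'a::chilbert_space bop set \<Rightarrow> ('a bop \<Rightarrow> 'a bop) \<Rightarrow> bool"
  where "schur_multiplier \<D> \<Phi> \<longleftrightarrow>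
    bimodule_map \<D> \<Phi> \<and> continuous_map weak_star_topology weak_star_topology \<Phi>"

definition schur_idempotents :: "'a::chilbert_space bop set \<Rightarrow> ('a bop \<Rightarrow> 'a bop) set"
  where "schur_idempotents \<D> = {\<Phi>. schur_multiplier \<D> \<Phi> \<and> \<Phi> \<circ> \<Phi> = \<Phi>}"

definition schur_meet ::
    "('a::chilbert_space bop \<Rightarrow> 'a bop) \<Rightarrow> ('a bop \<Rightarrow> 'a bop) \<Rightarrow> 'a bop \<Rightarrow> 'a bop"
  where "schur_meet \<Phi> \<Psi> = \<Phi> \<circ> \<Psi>"

definition schur_join ::
    "('a::chilbert_space bop \<Rightarrow> 'a bop) \<Rightarrow> ('a bop \<Rightarrow> 'a bop) \<Rightarrow> 'a bop \<Rightarrow> 'a bop"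
  where "schur_join \<Phi> \<Psi> = (\<lambda>T. \<Phi> T + \<Psi> T - \<Phi> (\<Psi> T))"

definition schur_compl :: "('a::chilbert_space bop \<Rightarrow> 'a bop) \<Rightarrow> 'a bop \<Rightarrow> 'a bop"
  where "schur_compl \<Phi> = (\<lambda>T. T - \<Phi> T)"

text \<open>
  The inserted \<open>0\<close> only matters for the zero space, which has no unit vectors: it makes the
  supremum over the empty set equal to \<open>0\<close>, whereas \<open>Sup {}\<close> is unspecified on the reals.
  Otherwise all members of the set are nonnegative and bounded by \<open>norm T\<close> if \<open>\<X>\<close> is a subspace.
\<close>

definition alpha :: "'a::chilbert_space bop \<Rightarrow> 'a bop set \<Rightarrow> real"
  where "alpha T \<X> =
    Sup (insert 0 {INF X\<in>\<X>. norm (bop_apply T \<xi> - bop_apply X \<xi>) | \<xi>. norm \<xi> = 1})"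

definition hyperreflexive_idempotents ::
    "'a::chilbert_space bop set \<Rightarrow> ('a bop \<Rightarrow> 'a bop) set"
  where "hyperreflexive_idempotents \<D> = {\<Phi> \<in> schur_idempotents \<D>.
    \<exists>c>0. \<forall>T. norm (schur_compl \<Phi> T) \<le> c * alpha T (range \<Phi>)}"

end

theory Submission
  imports Defs
begin

text \<open>
  For a \<open>\<D>\<close>-bimodule \<open>\<X>\<close> and a vector \<open>\<xi>\<close>, the projections onto the closures of \<open>\<D> \<xi>\<close> and
  \<open>\<X> \<xi>\<close> commute with \<open>\<D>\<close>, hence lie in \<open>\<D>\<close>.  If \<open>Q\<close> is the first and \<open>P\<close> the complement of the
  second, then \<open>P \<X> Q = 0\<close>, while the distance of \<open>T \<xi>\<close> from \<open>\<X> \<xi>\<close> is the norm of \<open>P T \<xi>\<close>.  Schur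
  multipliers pass through the compression \<open>T \<mapsto> P T Q\<close>.  Let \<open>\<Phi>\<close> and \<open>\<Psi>\<close> be
  hyperreflexive idempotents.

  First, \<open>\<Phi>\<close> leaves \<open>Ran \<Psi>\<close> invariant, that is \<open>\<Psi> \<Phi> \<Psi> = \<Phi> \<Psi>\<close>.  This relation and its mirror
  image already make \<open>\<Phi> \<Psi>\<close> and \<open>\<Phi> + \<Psi> - \<Phi> \<Psi>\<close> idempotent, so the general theorem that Schur
  multipliers commute is not needed.

  Secondly, \<open>T - \<Phi> \<Psi> T = (T - \<Psi> T) + (\<Psi> T - \<Phi> (\<Psi> T))\<close>, and \<open>\<alpha>(_, Ran \<Phi>)\<close> is
  1-Lipschitz, which settles the meet.

  Thirdly, the complement of the join is \<open>\<Phi>\<^sup>\<bottom> \<Psi>\<^sup>\<bottom>\<close>, and for \<open>\<X> = Ran \<Phi>\<close> the vector \<open>P \<Psi>\<^sup>\<bottom>(T) \<xi>\<close>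
  equals \<open>\<Psi>\<^sup>\<bottom>(P T Q) \<xi>\<close>.  Compression kills \<open>Ran \<Phi>\<close> and preserves \<open>Ran \<Psi>\<close>, so
  \<open>\<alpha>(P T Q, Ran \<Psi>) \<le> \<alpha>(T, Ran \<Phi> + Ran \<Psi>)\<close>.
\<close>

section \<open>Operators on a Hilbert space\<close>

lift_definition id_bop :: "'a::chilbert_space bop" is "\<lambda>x. x"
  by (auto intro: bounded_linear_ident)

lemmas bop_rep_eqs =
  zero_bop.rep_eq plus_bop.rep_eq minus_bop.rep_eq scaleC_bop.rep_eq bop_compose.rep_eq
  id_bop.rep_eq

lemma bounded_linear_bop: "bounded_linear (bop_apply T)"
  and bop_scaleC: "bop_apply T (c *\<^sub>C x) = c *\<^sub>C bop_apply T x"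
  using bop_apply[of T] by auto

lemma bop_add: "bop_apply T (x + y) = bop_apply T x + bop_apply T y"
  and bop_diff: "bop_apply T (x - y) = bop_apply T x - bop_apply T y"
  and bop_scaleR: "bop_apply T (r *\<^sub>R x) = r *\<^sub>R bop_apply T x"
  and bop_zero: "bop_apply T 0 = 0"
  using bounded_linear_bop[of T]
  by (simp_all add: linear_add linear_diff linear_scale linear_0 bounded_linear.linear)

lemmas bop_simps = bop_rep_eqs bop_scaleC bop_add bop_diff bop_zero

lemma bop_compose_distrib:
  "A o\<^sub>B (S + T) = A o\<^sub>B S + A o\<^sub>B T" "(S + T) o\<^sub>B A = S o\<^sub>B A + T o\<^sub>B A"
  "A o\<^sub>B (S - T) = A o\<^sub>B S - A o\<^sub>B T" "(S - T) o\<^sub>B A = S o\<^sub>B A - T o\<^sub>B A"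
  by (auto intro!: bop_eqI simp: bop_simps)

lemma norm_bop_apply_le: "norm (bop_apply T x) \<le> norm T * norm x"
  by (simp add: norm_bop.rep_eq onorm bounded_linear_bop)

section \<open>The complex inner product and the Cauchy-Schwarz inequality\<close>

lemma cinner_add_right: "cinner (x::'a::chilbert_space) (y + z) = cinner x y + cinner x z"
  by (metis cinner_commute cinner_add_left complex_cnj_add)

lemma cinner_scaleC_right: "cinner (x::'a::chilbert_space) (c *\<^sub>C y) = cnj c * cinner x y"
  by (metis cinner_commute cinner_scaleC_left complex_cnj_mult)

lemma cinner_diff_left: "cinner (x - y) (z::'a::chilbert_space) = cinner x z - cinner y z"
  by (metis add_diff_cancel diff_add_cancel cinner_add_left)

lemma cinner_zero_left: "cinner 0 (x::'a::chilbert_space) = 0"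
  using cinner_add_left[of 0 0 x] by simp

text \<open>Since \<open>cinner x (\<i> *\<^sub>C y)\<close> is \<open>- \<i> * cinner x y\<close>,
  its real part is the imaginary part of \<open>cinner x y\<close>. This upgrades real
  orthogonality, as delivered by nearest points, to complex orthogonality.\<close>

lemma cinner_eq_zeroI:
  assumes "inner x y = 0" and "inner x (\<i> *\<^sub>C y) = 0"
  shows "cinner x (y::'a::chilbert_space) = 0"
  using assms by (simp add: complex_eq_iff cinner_scaleC_right flip: Re_cinner)

lemma cinner_self_eq_zero: "cinner x x = 0 \<longleftrightarrow> x = (0::'a::chilbert_space)"
  by (simp add: cinner_self)

text \<open>Rotating \<open>u\<close> by the unimodular scalar \<open>c\<close> makes the inner
  product real and nonnegative, so that the real Cauchy-Schwarz inequality applies.\<close>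

lemma norm_cinner_le: "cmod (cinner u v) \<le> norm (u::'a::chilbert_space) * norm v"
proof (cases "cinner u v = 0")
  case False
  define c where "c = cnj (cinner u v) / cmod (cinner u v)"
  have "cmod c = 1"
    using False by (simp add: c_def norm_divide)
  have "c * cinner u v = of_real (cmod (cinner u v))"
    using False complex_norm_square[of "cinner u v"]
    by (simp add: c_def power2_eq_square mult.commute field_simps)
  then have "cmod (cinner u v) = Re (cinner (c *\<^sub>C u) v)"
    by (simp add: cinner_scaleC_left)
  also have "\<dots> \<le> norm (c *\<^sub>C u) * norm v"
    by (simp add: Re_cinner norm_cauchy_schwarz)
  finally show ?thesis
    by (simp add: norm_scaleC \<open>cmod c = 1\<close>)
qed simp

section \<open>Complex subspaces and their closures\<close>

lemma complex_subspace_imp_subspace: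
  "complex_vector.subspace M \<Longrightarrow> subspace (M :: 'a::chilbert_space set)"
  unfolding complex_vector.subspace_def subspace_def
  by (metis scaleC_of_real)

lemma complex_subspace_closure:
  assumes "complex_vector.subspace (M :: 'a::chilbert_space set)"
  shows "complex_vector.subspace (closure M)"
proof -
  have "c *\<^sub>C x \<in> closure M" if "x \<in> closure M" for c x
    by (rule set_mp[OF image_closure_subset[of M "\<lambda>x. c *\<^sub>C x" "closure M"]])
      (use assms that closure_subset[of M] in \<open>auto simp: complex_vector.subspace_scale
        intro!: linear_continuous_on bounded_linear_scaleC\<close>)
  moreover have "x + y \<in> closure M" if "x \<in> closure M" "y \<in> closure M" for x y
  proof -
    obtain f g where "\<And>n. f n \<in> M" "f \<longlonglongrightarrow> x" "\<And>n. g n \<in> M" "g \<longlonglongrightarrow> y"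
      using \<open>x \<in> closure M\<close> \<open>y \<in> closure M\<close> by (auto simp: closure_sequential)
    then show ?thesis
      unfolding closure_sequential
      by (intro exI[of _ "\<lambda>n. f n + g n"])
        (auto intro: tendsto_add complex_vector.subspace_add[OF assms])
  qed
  moreover have "0 \<in> closure M"
    using complex_vector.subspace_0[OF assms] closure_subset by blast
  ultimately show ?thesis
    by (simp add: complex_vector.subspace_def)
qed

lemma bop_maps_closure:
  assumes x: "x \<in> closure M" and T: "\<And>x. x \<in> M \<Longrightarrow> bop_apply T x \<in> N"
  shows "bop_apply T x \<in> closure N"
proof -
  have "bop_apply T ` closure M \<subseteq> closure N"
  proof (rule image_closure_subset)
    show "continuous_on (closure M) (bop_apply T)"
      by (rule linear_continuous_on[OF bounded_linear_bop])
    show "bop_apply T ` M \<subseteq> closure N"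
      using T closure_subset[of N] by blast
  qed simp
  with x show ?thesis
    by blast
qed


section \<open>Orthogonal projections\<close>

text \<open>A minimizing sequence for the distance is Cauchy by the parallelogram law, and its limit
  lies in the closed subspace.\<close>

lemma nearest_point_exists:
  fixes M :: "'a::{real_inner,complete_space} set"
  assumes M: "subspace M" "closed M"
  obtains p where "p \<in> M" and "\<And>m. m \<in> M \<Longrightarrow> norm (x - p) \<le> norm (x - m)"
proof -
  define d where "d = (INF m\<in>M. norm (x - m))"
  have "M \<noteq> {}"
    using M(1) subspace_0 by blast
  have bdd: "bdd_below ((\<lambda>m. norm (x - m)) ` M)"
    by (rule bdd_belowI[of _ 0]) auto
  have d_le: "d \<le> norm (x - m)" if "m \<in> M" for m
    unfolding d_def using bdd that by (rule cINF_lower)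
  have "0 \<le> d"
    unfolding d_def using \<open>M \<noteq> {}\<close> by (rule cINF_greatest) simp
  have "\<exists>m\<in>M. norm (x - m) < d + inverse (Suc n)" for n
    using cINF_less_iff[OF \<open>M \<noteq> {}\<close> bdd, of "d + inverse (Suc n)"]
    by (simp flip: d_def)
  then obtain f where f: "\<And>n. f n \<in> M" "\<And>n. norm (x - f n) < d + inverse (Suc n)"
    by metis
  have lim: "(\<lambda>n. norm (x - f n)) \<longlonglongrightarrow> d"
  proof (rule tendsto_sandwich[OF _ _ tendsto_const])
    show "(\<lambda>n. d + inverse (Suc n)) \<longlonglongrightarrow> d"
      using tendsto_add[OF tendsto_const LIMSEQ_inverse_real_of_nat, of d] by simp
  qed (use f d_le in \<open>auto simp: less_imp_le\<close>)
  \<comment> \<open>This is the parallelogram law for \<open>x - f i\<close> and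
    \<open>x - f j\<close>: the midpoint of \<open>f i\<close> and \<open>f j\<close> lies in
    \<open>M\<close>, hence at distance at least \<open>d\<close> from \<open>x\<close>.\<close>
  have par: "(norm (f i - f j))\<^sup>2 \<le> 2 * ((norm (x - f i))\<^sup>2 - d\<^sup>2) + 2 * ((norm (x - f j))\<^sup>2 - d\<^sup>2)"
    for i j
  proof -
    have "(1/2) *\<^sub>R (f i + f j) \<in> M"
      using M(1) f by (auto intro: subspace_add subspace_scale)
    then have "d\<^sup>2 \<le> (norm (x - (1/2) *\<^sub>R (f i + f j)))\<^sup>2"
      using d_le \<open>0 \<le> d\<close> by (intro power_mono) auto
    moreover have "(norm (f i - f j))\<^sup>2 + 4 * (norm (x - (1/2) *\<^sub>R (f i + f j)))\<^sup>2
        = 2 * (norm (x - f i))\<^sup>2 + 2 * (norm (x - f j))\<^sup>2"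
      by (simp add: power2_norm_eq_inner algebra_simps inner_commute)
    ultimately show ?thesis
      by simp
  qed
  have "Cauchy f"
  proof (rule CauchyI)
    fix e :: real assume "0 < e"
    have "(\<lambda>n. (norm (x - f n))\<^sup>2 - d\<^sup>2) \<longlonglongrightarrow> d\<^sup>2 - d\<^sup>2"
      by (intro tendsto_intros lim)
    then have "\<forall>\<^sub>F n in sequentially. (norm (x - f n))\<^sup>2 - d\<^sup>2 < e\<^sup>2 / 4"
      by (rule order_tendstoD) (use \<open>0 < e\<close> in simp)
    then obtain N where N: "\<And>n. N \<le> n \<Longrightarrow> (norm (x - f n))\<^sup>2 - d\<^sup>2 < e\<^sup>2 / 4"
      by (auto simp: eventually_sequentially)
    have "norm (f i - f j) < e" if "N \<le> i" "N \<le> j" for i j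
    proof -
      have "(norm (f i - f j))\<^sup>2 < e\<^sup>2"
        using par[of i j] N[OF that(1)] N[OF that(2)] by simp
      then show ?thesis
        using \<open>0 < e\<close> by (simp add: power_less_imp_less_base)
    qed
    then show "\<exists>N. \<forall>i\<ge>N. \<forall>j\<ge>N. norm (f i - f j) < e"
      by blast
  qed
  then obtain p where p: "f \<longlonglongrightarrow> p"
    by (auto simp: Cauchy_convergent_iff convergent_def)
  then have "(\<lambda>n. norm (x - f n)) \<longlonglongrightarrow> norm (x - p)"
    by (intro tendsto_intros)
  with lim have "norm (x - p) = d"
    by (rule LIMSEQ_unique[symmetric])
  moreover have "p \<in> M"
    using M(2) f(1) p by (auto simp: closed_sequential_limits)
  ultimately show thesis
    using that d_le by metis
qed

lemma nearest_point_orthogonal: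
  fixes M :: "'a::real_inner set"
  assumes "subspace M" "p \<in> M" "\<And>m. m \<in> M \<Longrightarrow> norm (x - p) \<le> norm (x - m)" "m \<in> M"
  shows "inner (x - p) m = 0"
proof (cases "m = 0")
  case False
  \<comment> \<open>This \<open>t\<close> minimizes the quadratic polynomial
    \<open>t \<mapsto> (norm (x - p - t *\<^sub>R m))\<^sup>2\<close>, so any nonzero inner product
    would yield a point of \<open>M\<close> strictly nearer than \<open>p\<close>.\<close>
  define t where "t = inner (x - p) m / inner m m"
  have "norm (x - p) \<le> norm (x - (p + t *\<^sub>R m))"
    using assms by (intro assms) (auto intro: subspace_add subspace_scale)
  then have "(norm (x - p))\<^sup>2 \<le> (norm ((x - p) - t *\<^sub>R m))\<^sup>2"
    by (intro power_mono) (auto simp: algebra_simps)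
  also have "\<dots> = (norm (x - p))\<^sup>2 - 2 * t * inner (x - p) m + t\<^sup>2 * inner m m"
    unfolding power2_norm_eq_inner
    by (simp add: inner_diff_left inner_diff_right inner_commute power2_eq_square)
  also have "\<dots> = (norm (x - p))\<^sup>2 - (inner (x - p) m)\<^sup>2 / inner m m"
    using False by (simp add: t_def power2_eq_square)
  finally have "(inner (x - p) m)\<^sup>2 / inner m m \<le> 0"
    by simp
  moreover have "0 < inner m m"
    using False by simp
  ultimately have "(inner (x - p) m)\<^sup>2 \<le> 0"
    by (simp add: divide_le_0_iff)
  then show ?thesis
    by simp
qed simp

text \<open>The vector \<open>p - q\<close> is both in \<open>M\<close> and orthogonal to
  \<open>M\<close>. Linearity of projections and their commutation with operators are later checked
  through this uniqueness.\<close>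

lemma orthogonal_component_unique:
  assumes M: "complex_vector.subspace (M :: 'a::chilbert_space set)"
    and p: "p \<in> M" "\<And>m. m \<in> M \<Longrightarrow> cinner (x - p) m = 0"
    and q: "q \<in> M" "\<And>m. m \<in> M \<Longrightarrow> cinner (x - q) m = 0"
  shows "p = q"
proof -
  have "p - q \<in> M"
    using M p(1) q(1) by (rule complex_vector.subspace_diff)
  then have "cinner ((x - q) - (x - p)) (p - q) = 0"
    by (subst cinner_diff_left) (simp add: p q)
  then show ?thesis
    by (simp add: cinner_self_eq_zero)
qed

text \<open>Pythagoras; it makes a projection and its complement contractions.\<close>

lemma orthogonal_component_norm_le:
  assumes "cinner (x - p) (p::'a::chilbert_space) = 0"
  shows "norm p \<le> norm x" and "norm (x - p) \<le> norm x"
proof -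
  have "inner (x - p) p = 0"
    using assms by (simp flip: Re_cinner)
  then have "(norm p)\<^sup>2 + (norm (x - p))\<^sup>2 = (norm x)\<^sup>2"
    by (simp add: power2_norm_eq_inner inner_diff_left inner_diff_right inner_commute)
  moreover have "0 \<le> (norm p)\<^sup>2" "0 \<le> (norm (x - p))\<^sup>2"
    by simp_all
  ultimately have "(norm p)\<^sup>2 \<le> (norm x)\<^sup>2" "(norm (x - p))\<^sup>2 \<le> (norm x)\<^sup>2"
    by linarith+
  then show "norm p \<le> norm x" "norm (x - p) \<le> norm x"
    by (auto intro: power2_le_imp_le)
qed

lemma projection_exists:
  assumes M: "complex_vector.subspace (M :: 'a::chilbert_space set)" "closed M"
  obtains P where "\<And>x. bop_apply P x \<in> M" "\<And>x m. m \<in> M \<Longrightarrow> cinner (x - bop_apply P x) m = 0"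
proof -
  have "\<exists>p. p \<in> M \<and> (\<forall>m\<in>M. cinner (x - p) m = 0)" for x
  proof -
    have sub: "subspace M"
      by (rule complex_subspace_imp_subspace[OF M(1)])
    obtain p where p: "p \<in> M" "\<And>m. m \<in> M \<Longrightarrow> norm (x - p) \<le> norm (x - m)"
      using nearest_point_exists[OF sub M(2)] by metis
    have "inner (x - p) m = 0" if "m \<in> M" for m
      using nearest_point_orthogonal[OF sub p that] .
    then show ?thesis
      using p(1) M(1) by (intro exI[of _ p]) (auto intro!: cinner_eq_zeroI complex_vector.subspace_scale)
  qed
  then obtain f where f: "\<And>x. f x \<in> M" "\<And>x m. m \<in> M \<Longrightarrow> cinner (x - f x) m = 0"
    by metis
  note unique = orthogonal_component_unique[OF M(1) f]
  have add: "f (x + y) = f x + f y" for x y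
  proof (rule unique)
    show "cinner (x + y - (f x + f y)) m = 0" if "m \<in> M" for m
      unfolding add_diff_add cinner_add_left by (simp add: f(2) that)
  qed (auto intro: complex_vector.subspace_add M f)
  have scale: "f (c *\<^sub>C x) = c *\<^sub>C f x" for c x
  proof (rule unique)
    show "cinner (c *\<^sub>C x - c *\<^sub>C f x) m = 0" if "m \<in> M" for m
      unfolding complex_vector.scale_right_diff_distrib[symmetric] cinner_scaleC_left
      by (simp add: f(2) that)
  qed (auto intro: complex_vector.subspace_scale M f)
  have "bounded_linear f"
  proof (rule bounded_linear_intro[where K = 1])
    show "f (r *\<^sub>R x) = r *\<^sub>R f x" for r x
      using scale[of "complex_of_real r" x] by (simp add: scaleC_of_real)
    show "norm (f x) \<le> norm x * 1" for x
      using orthogonal_component_norm_le(1)[OF f(2)[OF f(1)]] by simp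
  qed (rule add)
  then have "bop_apply (Bop f) = f"
    by (simp add: Bop_inverse scale)
  then show thesis
    using that[of "Bop f"] f by simp
qed


section \<open>Masas\<close>

lemma masa_projection_mem:
  assumes D: "masa (\<D> :: 'a::chilbert_space bop set)"
    and P: "P o\<^sub>B P = P" "is_adjoint P P" and comm: "\<And>A. A \<in> \<D> \<Longrightarrow> A o\<^sub>B P = P o\<^sub>B A"
  shows "P \<in> \<D>"
proof -
  have alg: "abelian_selfadjoint_algebra \<D>"
    and max: "\<And>\<E>. abelian_selfadjoint_algebra \<E> \<Longrightarrow> \<D> \<subseteq> \<E> \<Longrightarrow> \<E> = \<D>"
    using D by (auto simp: masa_def)
  have sub: "complex_vector.subspace \<D>"
    and mult: "\<And>A B. A \<in> \<D> \<Longrightarrow> B \<in> \<D> \<Longrightarrow> A o\<^sub>B B \<in> \<D>"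
    and abel: "\<And>A B. A \<in> \<D> \<Longrightarrow> B \<in> \<D> \<Longrightarrow> A o\<^sub>B B = B o\<^sub>B A"
    and adj: "\<And>A. A \<in> \<D> \<Longrightarrow> \<exists>S\<in>\<D>. is_adjoint S A"
    using alg by (auto simp: abelian_selfadjoint_algebra_def)
  note closed = complex_vector.subspace_0[OF sub] complex_vector.subspace_add[OF sub]
    complex_vector.subspace_scale[OF sub] mult
  \<comment> \<open>The algebra generated by \<open>\<D>\<close> and \<open>P\<close>; the term \<open>c *\<^sub>C P\<close> is needed because
    \<open>id_bop \<in> \<D>\<close> is not yet available, being itself a consequence of this lemma.\<close>
  define F where "F = (\<lambda>A B c. A + B o\<^sub>B P + c *\<^sub>C P)"
  define \<E> where "\<E> = {F A B c | A B c. A \<in> \<D> \<and> B \<in> \<D>}"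
  have mem: "F A B c \<in> \<E>" if "A \<in> \<D>" "B \<in> \<D>" for A B c
    using that by (auto simp: \<E>_def)
  have PP: "bop_apply P (bop_apply P x) = bop_apply P x" for x
    by (metis P(1) bop_compose.rep_eq)
  have PA: "bop_apply P (bop_apply A x) = bop_apply A (bop_apply P x)" if "A \<in> \<D>" for A x
    by (metis comm[OF that] bop_compose.rep_eq)
  have "F 0 0 0 = 0"
    unfolding F_def by (rule bop_eqI) (simp add: bop_simps)
  moreover have "F A B c + F A' B' c' = F (A + A') (B + B') (c + c')" for A B c A' B' c'
    unfolding F_def by (rule bop_eqI) (simp add: bop_simps scaleC_add_left)
  moreover have "d *\<^sub>C F A B c = F (d *\<^sub>C A) (d *\<^sub>C B) (d * c)" for A B c d
    unfolding F_def by (rule bop_eqI) (simp add: bop_simps scaleC_add_right)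
  ultimately have "complex_vector.subspace \<E>"
    unfolding complex_vector.subspace_def
    by (auto simp: \<E>_def) (metis closed(1), metis closed(2), metis closed(3))
  \<comment> \<open>Multiply out and move every \<open>P\<close> to the right past \<open>A'\<close>
    and \<open>B'\<close>; as \<open>P\<close> is idempotent, only one factor \<open>P\<close>
    survives in each term.\<close>
  moreover have mult_F: "F A B c o\<^sub>B F A' B' c' =
      F (A o\<^sub>B A') (A o\<^sub>B B' + c' *\<^sub>C A + B o\<^sub>B A' + B o\<^sub>B B' + c' *\<^sub>C B + c *\<^sub>C A' + c *\<^sub>C B') (c * c')"
    if "A' \<in> \<D>" "B' \<in> \<D>" for A B c A' B' c'
    unfolding F_def
    by (rule bop_eqI) (simp add: bop_simps PP PA that scaleC_add_right scaleC_scaleC algebra_simps)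
  moreover have "S o\<^sub>B T \<in> \<E>" if ST: "S \<in> \<E>" "T \<in> \<E>" for S T
  proof -
    obtain A B c A' B' c' where *: "S = F A B c" "T = F A' B' c'"
      "A \<in> \<D>" "B \<in> \<D>" "A' \<in> \<D>" "B' \<in> \<D>"
      using ST unfolding \<E>_def by blast
    then show ?thesis
      by (simp add: mult_F) (intro mem closed; simp)
  qed
  moreover have "S o\<^sub>B T = T o\<^sub>B S" if ST: "S \<in> \<E>" "T \<in> \<E>" for S T
  proof -
    obtain A B c A' B' c' where *: "S = F A B c" "T = F A' B' c'"
      "A \<in> \<D>" "B \<in> \<D>" "A' \<in> \<D>" "B' \<in> \<D>"
      using ST unfolding \<E>_def by blast
    then show ?thesis
      by (simp add: mult_F abel[of A' A] abel[of B' B] abel[of B' A] abel[of A' B] mult.commute[of c c']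
          add_ac)
  qed
  moreover have "\<exists>S\<in>\<E>. is_adjoint S T" if T: "T \<in> \<E>" for T
  proof -
    obtain A B c where *: "T = F A B c" "A \<in> \<D>" "B \<in> \<D>"
      using T unfolding \<E>_def by blast
    obtain A' B' where adj': "A' \<in> \<D>" "B' \<in> \<D>" "is_adjoint A' A" "is_adjoint B' B"
      using adj * by metis
    \<comment> \<open>The adjoint of \<open>B o\<^sub>B P\<close> is \<open>P o\<^sub>B B'\<close>,
      which equals \<open>B' o\<^sub>B P\<close> by \<open>PA\<close>.\<close>
    then have "is_adjoint (F A' B' (cnj c)) T"
      using P(2) unfolding is_adjoint_def *(1) F_def
      by (simp add: bop_simps cinner_add_left cinner_add_right cinner_scaleC_left
          cinner_scaleC_right flip: PA)
    then show ?thesis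
      using mem adj' by blast
  qed
  ultimately have "abelian_selfadjoint_algebra \<E>"
    by (auto simp: abelian_selfadjoint_algebra_def)
  moreover have "\<D> \<subseteq> \<E>"
  proof
    fix A assume "A \<in> \<D>"
    moreover have "F A 0 0 = A"
      unfolding F_def by (rule bop_eqI) (simp add: bop_simps)
    ultimately show "A \<in> \<E>"
      using mem closed(1) by metis
  qed
  ultimately have "\<E> = \<D>"
    by (rule max)
  moreover have "F 0 0 1 = P"
    unfolding F_def by (rule bop_eqI) (simp add: bop_simps)
  ultimately show ?thesis
    using mem closed(1) by metis
qed

text \<open>The definition of a masa does not mention a unit; maximality supplies it, because the
  identity is a projection commuting with everything.\<close>

lemma masa_id_mem: "masa \<D> \<Longrightarrow> id_bop \<in> \<D>"
  by (rule masa_projection_mem) (auto intro: bop_eqI simp: bop_simps is_adjoint_def)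

lemma masa_subspace: "masa \<D> \<Longrightarrow> complex_vector.subspace \<D>"
  by (simp add: masa_def abelian_selfadjoint_algebra_def)

text \<open>As \<D> is selfadjoint, an invariant subspace is reducing: the projection onto its
  closure commutes with \<D> and hence lies in \<D> by maximality.\<close>

lemma masa_invariant_projection:
  assumes D: "masa (\<D> :: 'a::chilbert_space bop set)"
    and M: "complex_vector.subspace M"
    and inv: "\<And>A x. A \<in> \<D> \<Longrightarrow> x \<in> M \<Longrightarrow> bop_apply A x \<in> M"
  obtains P where "P \<in> \<D>" "\<And>x. bop_apply P x \<in> closure M"
    "\<And>x. x \<in> closure M \<Longrightarrow> bop_apply P x = x"
    "\<And>x. norm (bop_apply P x) \<le> norm x" "\<And>x. norm (x - bop_apply P x) \<le> norm x"
proof -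
  let ?K = "closure M"
  have K: "complex_vector.subspace ?K"
    by (rule complex_subspace_closure[OF M])
  obtain P where P: "\<And>x. bop_apply P x \<in> ?K"
      "\<And>x m. m \<in> ?K \<Longrightarrow> cinner (x - bop_apply P x) m = 0"
    using projection_exists[OF K] by auto
  note unique = orthogonal_component_unique[OF K P]
  have fixK: "bop_apply P x = x" if "x \<in> ?K" for x
    by (rule unique) (use that in \<open>auto simp: cinner_zero_left\<close>)
  have invK: "bop_apply A x \<in> ?K" if "A \<in> \<D>" "x \<in> ?K" for A x
    using bop_maps_closure[OF that(2)] inv[OF that(1)] .
  have comm: "A o\<^sub>B P = P o\<^sub>B A" if A: "A \<in> \<D>" for A
  proof (rule bop_eqI)
    fix x
    obtain S where S: "S \<in> \<D>" "is_adjoint S A"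
      using D A by (auto simp: masa_def abelian_selfadjoint_algebra_def)
    \<comment> \<open>The adjoint \<open>S\<close> also leaves \<open>?K\<close> invariant, so
      \<open>A\<close> maps the orthogonal complement of \<open>?K\<close> into itself.\<close>
    have "bop_apply P (bop_apply A x) = bop_apply A (bop_apply P x)"
    proof (rule unique)
      show "bop_apply A (bop_apply P x) \<in> ?K"
        using invK[OF A P(1)] .
      show "cinner (bop_apply A x - bop_apply A (bop_apply P x)) m = 0" if "m \<in> ?K" for m
        using S(2) P(2)[OF invK[OF S(1) that], of x] by (simp add: is_adjoint_def flip: bop_diff)
    qed
    then show "bop_apply (A o\<^sub>B P) x = bop_apply (P o\<^sub>B A) x"
      by (simp add: bop_simps)
  qed
  have "is_adjoint P P"
    unfolding is_adjoint_def
  proof (intro allI)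
    fix x y
    have "cinner x (bop_apply P y) = cinner (bop_apply P x) (bop_apply P y)"
      using P(2)[OF P(1), of x y] by (simp add: cinner_diff_left)
    moreover have "cinner y (bop_apply P x) = cinner (bop_apply P y) (bop_apply P x)"
      using P(2)[OF P(1), of y x] by (simp add: cinner_diff_left)
    ultimately show "cinner (bop_apply P x) y = cinner x (bop_apply P y)"
      by (metis cinner_commute)
  qed
  moreover have "P o\<^sub>B P = P"
    by (rule bop_eqI) (simp add: bop_simps fixK P)
  ultimately have "P \<in> \<D>"
    using masa_projection_mem[OF D] comm by blast
  then show thesis
    using that P(1) fixK orthogonal_component_norm_le[OF P(2)[OF P(1)]] by blast
qed

text \<open>Left multiplication by \<D> makes the subspace \<X> \<xi> invariant under \<D>; right
  multiplication makes each \<open>S\<close> in \<X> map \<D> \<xi> into \<X> \<xi>. The projection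
  \<open>P\<close> is \<open>id_bop - R\<close>, where \<open>R\<close> projects onto the closure of
  \<X> \<xi>.\<close>

lemma separating_projections:
  fixes \<xi> :: "'a::chilbert_space"
  assumes D: "masa \<D>" and X: "complex_vector.subspace \<X>"
    and bimod: "\<forall>A\<in>\<D>. \<forall>S\<in>\<X>. A o\<^sub>B S \<in> \<X> \<and> S o\<^sub>B A \<in> \<X>"
  shows "\<exists>P\<in>\<D>. \<exists>Q\<in>\<D>. bop_apply Q \<xi> = \<xi> \<and>
    (\<forall>x. norm (bop_apply P x) \<le> norm x) \<and> (\<forall>x. norm (bop_apply Q x) \<le> norm x) \<and>
    (\<forall>S\<in>\<X>. P o\<^sub>B S o\<^sub>B Q = 0) \<and>
    (\<forall>T. (INF S\<in>\<X>. norm (bop_apply T \<xi> - bop_apply S \<xi>)) \<le> norm (bop_apply P (bop_apply T \<xi>)))"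
proof -
  have sub: "complex_vector.subspace ((\<lambda>S. bop_apply S \<xi>) ` \<Y>)"
    if "complex_vector.subspace \<Y>" for \<Y>
    using that unfolding complex_vector.subspace_def
    by (auto simp: image_iff) (metis zero_bop.rep_eq, metis plus_bop.rep_eq, metis scaleC_bop.rep_eq)
  have inv: "bop_apply A x \<in> (\<lambda>S. bop_apply S \<xi>) ` \<Y>"
    if "\<And>S. S \<in> \<Y> \<Longrightarrow> A o\<^sub>B S \<in> \<Y>" "x \<in> (\<lambda>S. bop_apply S \<xi>) ` \<Y>" for A x \<Y>
    using that by (auto simp: image_iff) (metis bop_compose.rep_eq)
  have multD: "\<And>A B. A \<in> \<D> \<Longrightarrow> B \<in> \<D> \<Longrightarrow> A o\<^sub>B B \<in> \<D>"
    using D by (auto simp: masa_def abelian_selfadjoint_algebra_def)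
  let ?MD = "(\<lambda>S. bop_apply S \<xi>) ` \<D>" and ?MX = "(\<lambda>S. bop_apply S \<xi>) ` \<X>"
  obtain Q where Q: "Q \<in> \<D>" "\<And>x. bop_apply Q x \<in> closure ?MD"
    "\<And>x. x \<in> closure ?MD \<Longrightarrow> bop_apply Q x = x" "\<And>x. norm (bop_apply Q x) \<le> norm x"
    using masa_invariant_projection[OF D sub[OF masa_subspace[OF D]] inv] multD by metis
  obtain R where R: "R \<in> \<D>" "\<And>x. bop_apply R x \<in> closure ?MX"
    "\<And>x. x \<in> closure ?MX \<Longrightarrow> bop_apply R x = x" "\<And>x. norm (x - bop_apply R x) \<le> norm x"
    using masa_invariant_projection[OF D sub[OF X] inv] bimod by metis
  show ?thesis
  proof (rule bexI[of _ "id_bop - R"], rule bexI[of _ Q], intro conjI allI ballI)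
    show "id_bop - R \<in> \<D>"
      using D R(1) by (simp add: complex_vector.subspace_diff masa_id_mem masa_subspace)
    show "Q \<in> \<D>"
      by fact
    show "norm (bop_apply Q x) \<le> norm x" for x
      by fact
    show "norm (bop_apply (id_bop - R) x) \<le> norm x" for x
      using R(4) by (simp add: bop_simps)
    have "\<xi> \<in> ?MD"
      using masa_id_mem[OF D] by (auto simp: image_iff id_bop.rep_eq intro: bexI[of _ id_bop])
    then show "bop_apply Q \<xi> = \<xi>"
      using Q(3)[OF subsetD[OF closure_subset]] by simp
    show "(id_bop - R) o\<^sub>B S o\<^sub>B Q = 0" if "S \<in> \<X>" for S
    proof (rule bop_eqI)
      fix x
      have "bop_apply S y \<in> ?MX" if "y \<in> ?MD" for y
        using that bimod \<open>S \<in> \<X>\<close> by (auto simp: image_iff) (metis bop_compose.rep_eq)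
      then have "bop_apply S (bop_apply Q x) \<in> closure ?MX"
        using bop_maps_closure Q(2) by blast
      then show "bop_apply ((id_bop - R) o\<^sub>B S o\<^sub>B Q) x = bop_apply 0 x"
        by (simp add: bop_simps R(3))
    qed
    show "(INF S\<in>\<X>. norm (bop_apply T \<xi> - bop_apply S \<xi>))
        \<le> norm (bop_apply (id_bop - R) (bop_apply T \<xi>))" for T
    \<comment> \<open>The nearest point \<open>R (T \<xi>)\<close> lies only in the closure of \<X>
      \<xi>, so it is approximated by some \<open>S \<xi>\<close> up to \<open>e\<close>.\<close>
    proof (rule field_le_epsilon)
      fix e :: real assume "0 < e"
      then obtain S where S: "S \<in> \<X>" "dist (bop_apply S \<xi>) (bop_apply R (bop_apply T \<xi>)) < e"
        using R(2)[of "bop_apply T \<xi>"] by (auto simp: closure_approachable)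
      have "(INF S\<in>\<X>. norm (bop_apply T \<xi> - bop_apply S \<xi>)) \<le> norm (bop_apply T \<xi> - bop_apply S \<xi>)"
        by (rule cINF_lower[OF bdd_belowI[of _ 0] S(1)]) auto
      also have "\<dots> \<le> norm (bop_apply T \<xi> - bop_apply R (bop_apply T \<xi>)) + e"
        using S(2) norm_triangle_ineq4[of "bop_apply T \<xi> - bop_apply R (bop_apply T \<xi>)"
            "bop_apply S \<xi> - bop_apply R (bop_apply T \<xi>)"]
        by (simp add: dist_norm)
      finally show "(INF S\<in>\<X>. norm (bop_apply T \<xi> - bop_apply S \<xi>))
          \<le> norm (bop_apply (id_bop - R) (bop_apply T \<xi>)) + e"
        by (simp add: bop_simps)
    qed
  qed
qed


section \<open>The seminorm \<open>\<alpha>\<close>\<close>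

lemma INF_norm_diff_le:
  "X \<in> \<X> \<Longrightarrow> (INF X\<in>\<X>. norm (bop_apply T \<xi> - bop_apply X \<xi>)) \<le> norm (bop_apply T \<xi> - bop_apply X \<xi>)"
  by (rule cINF_lower[OF bdd_belowI[of _ 0]]) auto

lemma alpha_leI:
  assumes "0 \<le> b"
    and "\<And>\<xi>. norm \<xi> = 1 \<Longrightarrow> (INF X\<in>\<X>. norm (bop_apply T \<xi> - bop_apply X \<xi>)) \<le> b"
  shows "alpha T \<X> \<le> b"
  unfolding alpha_def by (rule cSup_least) (use assms in auto)

text \<open>Testing with \<open>X = 0\<close> bounds each infimum by \<open>norm T\<close>; without
  such a bound the real \<open>Sup\<close> would carry no information.\<close>

lemma alpha_bdd_above:
  assumes "0 \<in> \<X>"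
  shows "bdd_above (insert 0 {INF X\<in>\<X>. norm (bop_apply T \<xi> - bop_apply X \<xi>) | \<xi>. norm \<xi> = 1})"
proof (rule bdd_aboveI[of _ "norm T"])
  fix a assume "a \<in> insert 0 {INF X\<in>\<X>. norm (bop_apply T \<xi> - bop_apply X \<xi>) | \<xi>. norm \<xi> = 1}"
  then consider "a = 0"
    | \<xi> where "norm \<xi> = 1" "a = (INF X\<in>\<X>. norm (bop_apply T \<xi> - bop_apply X \<xi>))"
    by blast
  then show "a \<le> norm T"
  proof cases
    case 2
    then have "a \<le> norm (bop_apply T \<xi>)"
      using INF_norm_diff_le[OF assms] by (simp add: zero_bop.rep_eq)
    with 2(1) show ?thesis
      using norm_bop_apply_le[of T \<xi>] by simp
  qed simp
qed

lemma alpha_nonneg: "0 \<in> \<X> \<Longrightarrow> 0 \<le> alpha T \<X>"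
  unfolding alpha_def by (rule cSup_upper[OF insertI1 alpha_bdd_above])

lemma INF_norm_diff_le_alpha:
  assumes "0 \<in> \<X>"
  shows "norm \<xi> = 1 \<Longrightarrow> (INF X\<in>\<X>. norm (bop_apply T \<xi> - bop_apply X \<xi>)) \<le> alpha T \<X>"
  unfolding alpha_def by (rule cSup_upper[OF _ alpha_bdd_above[OF assms]]) auto

text \<open>The infimum may not be attained, hence the slack \<open>e\<close>. Vectors in the whole
  unit ball are allowed because the join argument applies this to the image of a unit vector under a
  contraction; nonzero ones are normalized.\<close>

lemma alpha_approx:
  assumes "0 \<in> \<X>" and "0 < e" and "norm \<xi> \<le> 1"
  obtains X where "X \<in> \<X>" "norm (bop_apply (T - X) \<xi>) < alpha T \<X> + e"
proof (cases "\<xi> = 0")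
  case True
  then show ?thesis
    using that[OF assms(1)] alpha_nonneg[OF assms(1), of T] assms(2) by (simp add: bop_zero)
next
  case False
  define \<eta> where "\<eta> = inverse (norm \<xi>) *\<^sub>R \<xi>"
  have "norm \<eta> = 1"
    using False by (simp add: \<eta>_def)
  then have "(INF X\<in>\<X>. norm (bop_apply T \<eta> - bop_apply X \<eta>)) < alpha T \<X> + e"
    using INF_norm_diff_le_alpha[OF assms(1), of \<eta> T] assms(2) by simp
  moreover have "bdd_below ((\<lambda>X. norm (bop_apply T \<eta> - bop_apply X \<eta>)) ` \<X>)"
    by (rule bdd_belowI[of _ 0]) auto
  ultimately obtain X where X: "X \<in> \<X>" "norm (bop_apply T \<eta> - bop_apply X \<eta>) < alpha T \<X> + e"
    using assms(1) by (subst (asm) cINF_less_iff) auto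
  have "\<xi> = norm \<xi> *\<^sub>R \<eta>"
    using False by (simp add: \<eta>_def)
  then have "norm (bop_apply (T - X) \<xi>) = norm \<xi> * norm (bop_apply (T - X) \<eta>)"
    by (metis bop_scaleR norm_scaleR abs_norm_cancel)
  also have "\<dots> \<le> norm (bop_apply (T - X) \<eta>)"
    using assms(3) by (simp add: mult_left_le_one_le)
  finally show ?thesis
    using that X by (simp add: minus_bop.rep_eq)
qed

lemma alpha_leI_approx:
  assumes "0 \<le> b"
    and "\<And>\<xi> e. norm \<xi> = 1 \<Longrightarrow> 0 < e \<Longrightarrow> \<exists>X\<in>\<X>. norm (bop_apply (T - X) \<xi>) \<le> b + e"
  shows "alpha T \<X> \<le> b"
proof (rule alpha_leI[OF assms(1)], rule field_le_epsilon)
  fix \<xi> :: 'a and e :: real assume "norm \<xi> = 1" "0 < e"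
  then obtain X where "X \<in> \<X>" "norm (bop_apply (T - X) \<xi>) \<le> b + e"
    using assms(2) by blast
  then show "(INF X\<in>\<X>. norm (bop_apply T \<xi> - bop_apply X \<xi>)) \<le> b + e"
    using INF_norm_diff_le[of X \<X> T \<xi>] by (simp add: minus_bop.rep_eq)
qed

text \<open>An approximant of \<open>T\<close> from \<X> also serves \<open>S\<close>, at the cost
  of \<open>norm (S - T)\<close>. With \<open>S = T\<close> this says that \<open>alpha\<close>
  decreases when the subspace grows.\<close>

lemma alpha_lipschitz_mono:
  assumes "0 \<in> \<X>" "\<X> \<subseteq> \<Y>"
  shows "alpha S \<Y> \<le> alpha T \<X> + norm (S - T)"
proof (rule alpha_leI_approx)
  fix \<xi> :: 'a and e :: real assume \<xi>: "norm \<xi> = 1" and "0 < e"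
  then obtain X where X: "X \<in> \<X>" "norm (bop_apply (T - X) \<xi>) < alpha T \<X> + e"
    using alpha_approx[OF assms(1), of e \<xi>] by auto
  have "bop_apply (S - X) \<xi> = bop_apply (T - X) \<xi> + bop_apply (S - T) \<xi>"
    by (simp add: minus_bop.rep_eq)
  then have "norm (bop_apply (S - X) \<xi>) \<le> norm (bop_apply (T - X) \<xi>) + norm (S - T)"
    using norm_triangle_ineq[of "bop_apply (T - X) \<xi>" "bop_apply (S - T) \<xi>"]
      norm_bop_apply_le[of "S - T" \<xi>] \<xi> by simp
  with X show "\<exists>X\<in>\<Y>. norm (bop_apply (S - X) \<xi>) \<le> alpha T \<X> + norm (S - T) + e"
    using assms(2) by (intro bexI[of _ X]) auto
qed (simp add: alpha_nonneg[OF assms(1)])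


section \<open>Schur multipliers\<close>

text \<open>The defining series may be added termwise because it converges absolutely:
  Cauchy-Schwarz and the bound of a product by a sum of squares dominate it by the two
  square-summable sequences.\<close>

lemma weak_star_functional_add_diff:
  assumes "\<omega> \<in> weak_star_functionals"
  shows "\<omega> (S + T) = \<omega> S + \<omega> (T :: 'a::chilbert_space bop)"
    and "\<omega> (S - T) = \<omega> S - \<omega> T"
proof -
  obtain x y :: "nat \<Rightarrow> 'a" where xy: "summable (\<lambda>n. (norm (x n))\<^sup>2)" "summable (\<lambda>n. (norm (y n))\<^sup>2)"
    and \<omega>: "\<omega> = (\<lambda>T. \<Sum>n. cinner (bop_apply T (x n)) (y n))"
    using assms by (auto simp: weak_star_functionals_def)
  have summ: "summable (\<lambda>n. cinner (bop_apply T (x n)) (y n))" for T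
  proof (rule summable_comparison_test'[where N = 0])
    show "summable (\<lambda>n. norm T * ((norm (x n))\<^sup>2 + (norm (y n))\<^sup>2))"
      by (intro summable_mult summable_add xy)
    show "norm (cinner (bop_apply T (x n)) (y n)) \<le> norm T * ((norm (x n))\<^sup>2 + (norm (y n))\<^sup>2)" for n
    proof -
      have "norm (cinner (bop_apply T (x n)) (y n)) \<le> norm (bop_apply T (x n)) * norm (y n)"
        by (rule norm_cinner_le)
      also have "\<dots> \<le> norm T * norm (x n) * norm (y n)"
        by (intro mult_right_mono norm_bop_apply_le norm_ge_zero)
      also have "\<dots> = norm T * (norm (x n) * norm (y n))"
        by (rule mult.assoc)
      also have "\<dots> \<le> norm T * ((norm (x n))\<^sup>2 + (norm (y n))\<^sup>2)"
      proof (rule mult_left_mono)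
        have "2 * (norm (x n) * norm (y n)) \<le> (norm (x n))\<^sup>2 + (norm (y n))\<^sup>2"
          using sum_squares_bound[of "norm (x n)" "norm (y n)"] by (simp add: mult.assoc)
        moreover have "0 \<le> norm (x n) * norm (y n)"
          by simp
        ultimately show "norm (x n) * norm (y n) \<le> (norm (x n))\<^sup>2 + (norm (y n))\<^sup>2"
          by linarith
      qed simp
      finally show ?thesis .
    qed
  qed
  show "\<omega> (S + T) = \<omega> S + \<omega> T" "\<omega> (S - T) = \<omega> S - \<omega> T"
    by (simp_all add: \<omega> plus_bop.rep_eq minus_bop.rep_eq cinner_add_left cinner_diff_left
        suminf_add suminf_diff summ)
qed

lemma topspace_weak_star: "topspace (weak_star_topology :: 'a::chilbert_space bop topology) = UNIV"
proof -
  \<comment> \<open>The zero functional puts \<open>UNIV\<close> into the generating family, whose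
    union is the underlying space of the topology.\<close>
  have "(\<lambda>T. \<Sum>n. cinner (bop_apply T (0::'a)) (0::'a)) \<in> weak_star_functionals"
    unfolding weak_star_functionals_def
    by (rule CollectI, rule exI[of _ "\<lambda>_. 0"], rule exI[of _ "\<lambda>_. 0"]) simp
  then have "UNIV \<in> {\<omega> -` U | \<omega> U. \<omega> \<in> (weak_star_functionals :: ('a bop \<Rightarrow> complex) set) \<and> open U}"
    by (intro CollectI exI[of _ UNIV] exI conjI) auto
  then show ?thesis
    by (auto simp: weak_star_topology_def topology_generated_by_topspace)
qed

text \<open>The weak* topology is the initial topology of its functionals. Continuity of sums of
  maps thus reduces to that of complex-valued functions.\<close>

lemma continuous_map_weak_star_iff:
  "continuous_map weak_star_topology weak_star_topology (F :: 'a::chilbert_space bop \<Rightarrow> 'a bop) \<longleftrightarrow>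
    (\<forall>\<omega>\<in>weak_star_functionals. continuous_map weak_star_topology euclidean (\<lambda>T. \<omega> (F T)))"
  (is "?L \<longleftrightarrow> ?R")
proof
  assume L: ?L
  have "continuous_map weak_star_topology euclidean \<omega>"
    if "\<omega> \<in> weak_star_functionals" for \<omega> :: "'a bop \<Rightarrow> complex"
    unfolding continuous_map_alt topspace_weak_star
    using that by (auto simp: weak_star_topology_def intro!: topology_generated_by_Basis)
  then show ?R
    using continuous_map_compose[OF L] by (auto simp: o_def)
next
  assume R: ?R
  show ?L
    unfolding weak_star_topology_def[where 'a = 'a]
  proof (rule continuous_on_generated_topo, fold weak_star_topology_def)
    fix V :: "'a bop set"
    assume "V \<in> {\<omega> -` U | \<omega> U. \<omega> \<in> weak_star_functionals \<and> open U}"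
    then obtain \<omega> U where V: "V = \<omega> -` U" "\<omega> \<in> weak_star_functionals" "open U"
      by blast
    then have "openin weak_star_topology ((\<lambda>T. \<omega> (F T)) -` U \<inter> topspace weak_star_topology)"
      using R by (auto simp: continuous_map_alt)
    then show "openin weak_star_topology (F -` V \<inter> topspace weak_star_topology)"
      by (simp add: V(1) vimage_def)
  next
    show "F ` topspace weak_star_topology
        \<subseteq> \<Union> {\<omega> -` U | \<omega> U. \<omega> \<in> (weak_star_functionals :: ('a bop \<Rightarrow> complex) set) \<and> open U}"
      using topspace_weak_star[where 'a = 'a]
      by (simp add: weak_star_topology_def)
  qed
qed

section \<open>Algebra of bimodule maps and Schur multipliers\<close>

lemma bimodule_map_iff:
  "bimodule_map \<D> \<Phi> \<longleftrightarrow> (\<forall>S T. \<Phi> (S + T) = \<Phi> S + \<Phi> T) \<and> (\<forall>c T. \<Phi> (c *\<^sub>C T) = c *\<^sub>C \<Phi> T) \<and>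
    (\<forall>A\<in>\<D>. \<forall>T. \<Phi> (A o\<^sub>B T) = A o\<^sub>B \<Phi> T \<and> \<Phi> (T o\<^sub>B A) = \<Phi> T o\<^sub>B A)"
  by (auto simp: bimodule_map_def Vector_Spaces.linear_iff complex_vector.vector_space_axioms)

lemma bimodule_mapD:
  assumes "bimodule_map \<D> \<Phi>"
  shows "\<Phi> (S + T) = \<Phi> S + \<Phi> T" and "\<Phi> (c *\<^sub>C T) = c *\<^sub>C \<Phi> T"
    and "\<Phi> 0 = 0" and "\<Phi> (S - T) = \<Phi> S - \<Phi> T"
    and "A \<in> \<D> \<Longrightarrow> \<Phi> (A o\<^sub>B T) = A o\<^sub>B \<Phi> T" and "A \<in> \<D> \<Longrightarrow> \<Phi> (T o\<^sub>B A) = \<Phi> T o\<^sub>B A"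
proof -
  have add: "\<Phi> (S + T) = \<Phi> S + \<Phi> T" for S T
    using assms by (simp add: bimodule_map_iff)
  show "\<Phi> (S + T) = \<Phi> S + \<Phi> T"
    by (rule add)
  show "\<Phi> 0 = 0"
    using add[of 0 0] by simp
  show "\<Phi> (S - T) = \<Phi> S - \<Phi> T"
    using add[of "S - T" T] by simp
qed (use assms in \<open>auto simp: bimodule_map_iff\<close>)

lemma bimodule_map_range_subspace:
  assumes "bimodule_map \<D> \<Phi>"
  shows "complex_vector.subspace (range \<Phi>)"
  unfolding complex_vector.subspace_def
  by (auto simp flip: bimodule_mapD(1,2)[OF assms]) (metis bimodule_mapD(3)[OF assms] rangeI)

lemma bimodule_map_range_mult:
  assumes "bimodule_map \<D> \<Phi>"
  shows "\<forall>A\<in>\<D>. \<forall>S\<in>range \<Phi>. A o\<^sub>B S \<in> range \<Phi> \<and> S o\<^sub>B A \<in> range \<Phi>"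
  by (auto simp flip: bimodule_mapD(5,6)[OF assms])

lemma bimodule_map_comp:
  "bimodule_map \<D> \<Phi> \<Longrightarrow> bimodule_map \<D> \<Psi> \<Longrightarrow> bimodule_map \<D> (\<lambda>T. \<Phi> (\<Psi> T))"
  by (simp add: bimodule_map_iff)

lemma bimodule_map_add_diff:
  assumes "bimodule_map \<D> \<Phi>" "bimodule_map \<D> \<Psi>"
  shows "bimodule_map \<D> (\<lambda>T. \<Phi> T + \<Psi> T)" and "bimodule_map \<D> (\<lambda>T. \<Phi> T - \<Psi> T)"
  using assms
  by (simp_all add: bimodule_map_iff bop_compose_distrib scaleC_add_right
      complex_vector.scale_right_diff_distrib)

lemma schur_multiplier_comp:
  "schur_multiplier \<D> \<Phi> \<Longrightarrow> schur_multiplier \<D> \<Psi> \<Longrightarrow> schur_multiplier \<D> (\<lambda>T. \<Phi> (\<Psi> T))"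
  using bimodule_map_comp continuous_map_compose[of _ _ \<Psi> _ \<Phi>]
  by (auto simp: schur_multiplier_def o_def)

lemma schur_multiplier_add_diff:
  assumes "schur_multiplier \<D> \<Phi>" "schur_multiplier \<D> \<Psi>"
  shows "schur_multiplier \<D> (\<lambda>T. \<Phi> T + \<Psi> T)" and "schur_multiplier \<D> (\<lambda>T. \<Phi> T - \<Psi> T)"
  using assms
  by (auto simp: schur_multiplier_def bimodule_map_add_diff continuous_map_weak_star_iff
      weak_star_functional_add_diff intro: continuous_map_add continuous_map_diff)


section \<open>Hyperreflexive Schur idempotents\<close>

lemma schur_idempotentsD:
  assumes "\<Phi> \<in> schur_idempotents \<D>"
  shows "schur_multiplier \<D> \<Phi>" "bimodule_map \<D> \<Phi>" "\<Phi> (\<Phi> T) = \<Phi> T"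
  using assms by (auto simp: schur_idempotents_def schur_multiplier_def fun_eq_iff)

lemma hyperreflexive_idempotentsD:
  assumes "\<Phi> \<in> hyperreflexive_idempotents \<D>"
  shows "\<Phi> \<in> schur_idempotents \<D>"
    and "\<exists>c>0. \<forall>T. norm (T - \<Phi> T) \<le> c * alpha T (range \<Phi>)"
  using assms by (auto simp: hyperreflexive_idempotents_def schur_compl_def)

text \<open>The compression by \<open>P\<close> and \<open>Q\<close> kills the range of \<Psi> and
  commutes with \<Phi>, so it kills \<Phi> (\<Psi> T) as well. Hence \<open>alpha\<close> vanishes
  there, and hyperreflexivity of \<Psi> puts \<Phi> (\<Psi> T) into the range of \<Psi>.\<close>

lemma bimodule_map_leaves_range_invariant:
  assumes D: "masa \<D>" and \<Phi>: "bimodule_map \<D> \<Phi>" and \<Psi>: "\<Psi> \<in> hyperreflexive_idempotents \<D>"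
  shows "\<Psi> (\<Phi> (\<Psi> T)) = \<Phi> (\<Psi> T)"
proof -
  have \<Psi>': "bimodule_map \<D> \<Psi>"
    using hyperreflexive_idempotentsD(1)[OF \<Psi>] schur_idempotentsD(2) by blast
  have "alpha (\<Phi> (\<Psi> T)) (range \<Psi>) \<le> 0"
  proof (rule alpha_leI)
    fix \<xi> :: 'a
    obtain P Q where "P \<in> \<D>" "Q \<in> \<D>" "bop_apply Q \<xi> = \<xi>"
      "\<forall>x. norm (bop_apply P x) \<le> norm x" "\<forall>x. norm (bop_apply Q x) \<le> norm x"
      "\<forall>S\<in>range \<Psi>. P o\<^sub>B S o\<^sub>B Q = 0"
      "\<forall>T. (INF S\<in>range \<Psi>. norm (bop_apply T \<xi> - bop_apply S \<xi>)) \<le> norm (bop_apply P (bop_apply T \<xi>))"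
      using separating_projections[OF D bimodule_map_range_subspace bimodule_map_range_mult,
          OF \<Psi>' \<Psi>', of \<xi>]
      by (elim bexE conjE) (rule that)
    note PQ = this[rule_format]
    have "P o\<^sub>B \<Phi> (\<Psi> T) o\<^sub>B Q = \<Phi> (P o\<^sub>B \<Psi> T o\<^sub>B Q)"
      by (simp add: bimodule_mapD(5,6)[OF \<Phi>] PQ(1,2))
    also have "\<dots> = 0"
      by (simp add: PQ(6) bimodule_mapD(3)[OF \<Phi>])
    finally have "bop_apply (P o\<^sub>B \<Phi> (\<Psi> T) o\<^sub>B Q) \<xi> = 0"
      by (simp add: bop_simps)
    then show "(INF S\<in>range \<Psi>. norm (bop_apply (\<Phi> (\<Psi> T)) \<xi> - bop_apply S \<xi>)) \<le> 0"
      using PQ(7)[of "\<Phi> (\<Psi> T)"] by (simp add: bop_compose.rep_eq PQ(3))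
  qed simp
  moreover obtain c where "c > 0" "norm (\<Phi> (\<Psi> T) - \<Psi> (\<Phi> (\<Psi> T))) \<le> c * alpha (\<Phi> (\<Psi> T)) (range \<Psi>)"
    using hyperreflexive_idempotentsD(2)[OF \<Psi>] by blast
  ultimately have "norm (\<Phi> (\<Psi> T) - \<Psi> (\<Phi> (\<Psi> T))) \<le> 0"
    by (meson dual_order.trans mult_nonneg_nonpos less_imp_le)
  then show ?thesis
    by simp
qed

lemma schur_meet_hyperreflexive:
  assumes D: "masa \<D>" and \<Phi>: "\<Phi> \<in> hyperreflexive_idempotents \<D>"
    and \<Psi>: "\<Psi> \<in> hyperreflexive_idempotents \<D>"
  shows "schur_meet \<Phi> \<Psi> \<in> hyperreflexive_idempotents \<D>"
proof -
  note \<Phi>s = schur_idempotentsD[OF hyperreflexive_idempotentsD(1)[OF \<Phi>]]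
  note \<Psi>s = schur_idempotentsD[OF hyperreflexive_idempotentsD(1)[OF \<Psi>]]
  let ?\<Theta> = "\<lambda>T. \<Phi> (\<Psi> T)"
  have inv: "\<Psi> (\<Phi> (\<Psi> T)) = \<Phi> (\<Psi> T)" for T
    by (rule bimodule_map_leaves_range_invariant[OF D \<Phi>s(2) \<Psi>])
  have sub: "range ?\<Theta> \<subseteq> range \<Phi>" "range ?\<Theta> \<subseteq> range \<Psi>"
    by (auto, metis inv rangeI)
  have zero: "0 \<in> range ?\<Theta>"
    by (metis bimodule_mapD(3) \<Phi>s(2) \<Psi>s(2) rangeI)
  have "?\<Theta> \<in> schur_idempotents \<D>"
    by (simp add: schur_idempotents_def schur_multiplier_comp \<Phi>s \<Psi>s fun_eq_iff inv)
  moreover obtain c where c: "c > 0" "\<And>T. norm (T - \<Phi> T) \<le> c * alpha T (range \<Phi>)"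
    using hyperreflexive_idempotentsD(2)[OF \<Phi>] by blast
  moreover obtain d where d: "d > 0" "\<And>T. norm (T - \<Psi> T) \<le> d * alpha T (range \<Psi>)"
    using hyperreflexive_idempotentsD(2)[OF \<Psi>] by blast
  \<comment> \<open>The summand \<open>d\<close> pays for \<open>T - \<Psi> T\<close>. The other
    pays for \<open>\<Psi> T - \<Phi> (\<Psi> T)\<close>, where replacing \<open>T\<close> by
    \<open>\<Psi> T\<close> inside \<open>alpha\<close> enlarges the bound by the factor
    \<open>1 + d\<close>.\<close>
  have "norm (T - ?\<Theta> T) \<le> (d + c * (1 + d)) * alpha T (range ?\<Theta>)" for T
  proof -
    let ?a = "alpha T (range ?\<Theta>)"
    have "norm (T - \<Psi> T) \<le> d * ?a"
      using d(2)[of T] alpha_lipschitz_mono[OF zero sub(2), of T T] d(1)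
      by (smt (verit) mult_left_mono diff_self norm_zero)
    moreover have "alpha (\<Psi> T) (range \<Phi>) \<le> ?a + norm (\<Psi> T - T)"
      by (rule alpha_lipschitz_mono[OF zero sub(1)])
    ultimately have "alpha (\<Psi> T) (range \<Phi>) \<le> (1 + d) * ?a"
      by (simp add: norm_minus_commute algebra_simps)
    then have "norm (\<Psi> T - ?\<Theta> T) \<le> c * ((1 + d) * ?a)"
      using c by (meson dual_order.trans mult_left_mono less_imp_le)
    with \<open>norm (T - \<Psi> T) \<le> d * ?a\<close> show ?thesis
      using norm_triangle_ineq[of "T - \<Psi> T" "\<Psi> T - ?\<Theta> T"] by (simp add: algebra_simps)
  qed
  moreover have "d + c * (1 + d) > 0"
    using c(1) d(1) by (simp add: pos_add_strict)
  ultimately show ?thesis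
    unfolding hyperreflexive_idempotents_def schur_meet_def schur_compl_def o_def by blast
qed

lemma schur_join_hyperreflexive:
  assumes D: "masa \<D>" and \<Phi>: "\<Phi> \<in> hyperreflexive_idempotents \<D>"
    and \<Psi>: "\<Psi> \<in> hyperreflexive_idempotents \<D>"
  shows "schur_join \<Phi> \<Psi> \<in> hyperreflexive_idempotents \<D>"
proof -
  note \<Phi>s = schur_idempotentsD[OF hyperreflexive_idempotentsD(1)[OF \<Phi>]]
  note \<Psi>s = schur_idempotentsD[OF hyperreflexive_idempotentsD(1)[OF \<Psi>]]
  note \<Phi>_simps = bimodule_mapD[OF \<Phi>s(2)] and \<Psi>_simps = bimodule_mapD[OF \<Psi>s(2)]
  let ?\<Theta> = "\<lambda>T. \<Phi> T + \<Psi> T - \<Phi> (\<Psi> T)"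
  have inv: "\<Psi> (\<Phi> (\<Psi> T)) = \<Phi> (\<Psi> T)" "\<Phi> (\<Psi> (\<Phi> T)) = \<Psi> (\<Phi> T)" for T
    by (rule bimodule_map_leaves_range_invariant[OF D \<Phi>s(2) \<Psi>])
      (rule bimodule_map_leaves_range_invariant[OF D \<Psi>s(2) \<Phi>])
  \<comment> \<open>Expanding the square, \<open>inv\<close> turns \<Psi> \<Phi> \<Psi> into \<Phi>
    \<Psi> and \<Phi> \<Psi> \<Phi> into \<Psi> \<Phi>; the mixed terms then cancel down to a single
    - \<Phi> \<Psi>.\<close>
  have "?\<Theta> \<in> schur_idempotents \<D>"
    by (simp add: schur_idempotents_def schur_multiplier_comp schur_multiplier_add_diff \<Phi>s \<Psi>s
        fun_eq_iff \<Phi>_simps \<Psi>_simps inv)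
  have zero: "0 \<in> range ?\<Theta>"
    by (rule range_eqI[of _ _ 0]) (simp add: \<Phi>_simps \<Psi>_simps)
  have zero\<Psi>: "0 \<in> range \<Psi>"
    by (metis \<Psi>_simps(3) rangeI)
  obtain c where c: "c > 0" "\<And>T. norm (T - \<Phi> T) \<le> c * alpha T (range \<Phi>)"
    using hyperreflexive_idempotentsD(2)[OF \<Phi>] by blast
  obtain d where d: "d > 0" "\<And>T. norm (T - \<Psi> T) \<le> d * alpha T (range \<Psi>)"
    using hyperreflexive_idempotentsD(2)[OF \<Psi>] by blast
  have "norm (T - ?\<Theta> T) \<le> (c * d) * alpha T (range ?\<Theta>)" for T
  proof -
    let ?a = "alpha T (range ?\<Theta>)"
    have "alpha (T - \<Psi> T) (range \<Phi>) \<le> d * ?a"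
    proof (rule alpha_leI)
      show "0 \<le> d * ?a"
        using d(1) alpha_nonneg[OF zero] by simp
      fix \<xi> :: 'a assume \<xi>: "norm \<xi> = 1"
      obtain P Q where "P \<in> \<D>" "Q \<in> \<D>" "bop_apply Q \<xi> = \<xi>"
        "\<forall>x. norm (bop_apply P x) \<le> norm x" "\<forall>x. norm (bop_apply Q x) \<le> norm x"
        "\<forall>S\<in>range \<Phi>. P o\<^sub>B S o\<^sub>B Q = 0"
        "\<forall>T. (INF S\<in>range \<Phi>. norm (bop_apply T \<xi> - bop_apply S \<xi>)) \<le> norm (bop_apply P (bop_apply T \<xi>))"
        using separating_projections[OF D bimodule_map_range_subspace bimodule_map_range_mult,
            OF \<Phi>s(2) \<Phi>s(2), of \<xi>]
        by (elim bexE conjE) (rule that)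
      note PQ = this[rule_format]
      let ?C = "\<lambda>S. P o\<^sub>B S o\<^sub>B Q"
      have compress: "alpha (?C T) (range \<Psi>) \<le> ?a"
      proof (rule alpha_leI_approx)
        show "0 \<le> ?a"
          by (rule alpha_nonneg[OF zero])
        fix \<eta> :: 'a and e :: real assume "norm \<eta> = 1" "0 < e"
        \<comment> \<open>The vector \<open>Q \<eta>\<close> need not be a unit vector, but it stays
          in the unit ball.\<close>
        then have "norm (bop_apply Q \<eta>) \<le> 1"
          using PQ(5)[of \<eta>] by simp
        then obtain Z where Z: "Z \<in> range ?\<Theta>" "norm (bop_apply (T - Z) (bop_apply Q \<eta>)) < ?a + e"
          by (rule alpha_approx[OF zero \<open>0 < e\<close>])
        then obtain A where A: "Z = ?\<Theta> A"
          by blast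
        \<comment> \<open>An element of the range of the join splits as
          \<open>\<Phi> (A - \<Psi> A) + \<Psi> A\<close>. The compression kills the first part and
          passes through \<Psi> in the second, so \<open>?C Z\<close> lies in the range of
          \<Psi>.\<close>
        have "?C Z = ?C (\<Phi> (A - \<Psi> A)) + ?C (\<Psi> A)"
          by (simp add: A \<Phi>_simps bop_compose_distrib)
        also have "\<dots> = \<Psi> (?C A)"
          by (simp add: PQ \<Psi>_simps)
        finally have "?C T - \<Psi> (?C A) = ?C (T - Z)"
          by (simp add: bop_compose_distrib)
        then have "norm (bop_apply (?C T - \<Psi> (?C A)) \<eta>) \<le> norm (bop_apply (T - Z) (bop_apply Q \<eta>))"
          by (simp add: bop_compose.rep_eq PQ(4))
        with Z(2) show "\<exists>X\<in>range \<Psi>. norm (bop_apply (?C T - X) \<eta>) \<le> ?a + e"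
          by (intro bexI[of _ "\<Psi> (?C A)"]) auto
      qed
      \<comment> \<open>As \<open>Q\<close> fixes \<xi>, the vector can be computed from the
        compressed operator, to which hyperreflexivity of \<Psi> applies together with
        \<open>compress\<close>.\<close>
      have "bop_apply P (bop_apply (T - \<Psi> T) \<xi>) = bop_apply (?C (T - \<Psi> T)) \<xi>"
        by (simp add: bop_compose.rep_eq PQ(3))
      also have "?C (T - \<Psi> T) = ?C T - \<Psi> (?C T)"
        by (simp add: \<Psi>_simps PQ(1,2) bop_compose_distrib)
      finally have "norm (bop_apply P (bop_apply (T - \<Psi> T) \<xi>)) \<le> norm (?C T - \<Psi> (?C T))"
        using norm_bop_apply_le[of "?C T - \<Psi> (?C T)" \<xi>] \<xi> by simp
      also have "\<dots> \<le> d * ?a"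
        using d compress by (meson dual_order.trans mult_left_mono less_imp_le)
      finally show "(INF S\<in>range \<Phi>. norm (bop_apply (T - \<Psi> T) \<xi> - bop_apply S \<xi>)) \<le> d * ?a"
        using PQ(7) by (rule order_trans[rotated])
    qed
    then have "c * alpha (T - \<Psi> T) (range \<Phi>) \<le> c * d * ?a"
      using c(1) by simp
    with c(2) have "norm ((T - \<Psi> T) - \<Phi> (T - \<Psi> T)) \<le> c * d * ?a"
      by (rule order_trans)
    \<comment> \<open>The complement of the join is the product of the two complements, which
      explains the constant \<open>c * d\<close>.\<close>
    moreover have "(T - \<Psi> T) - \<Phi> (T - \<Psi> T) = T - ?\<Theta> T"
      by (simp add: \<Phi>_simps)
    ultimately show ?thesis
      by (simp only:)
  qed
  then show ?thesis
    using \<open>?\<Theta> \<in> schur_idempotents \<D>\<close> c(1) d(1)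
    unfolding hyperreflexive_idempotents_def schur_join_def schur_compl_def
    by (auto intro!: exI[of _ "c * d"])
qed

theorem theorem3p10:
  fixes \<D> :: "'a::chilbert_space bop set"
  assumes separable: "separable_space (euclidean :: 'a topology)"
    and masa: "masa \<D>"
  shows "hyperreflexive_idempotents \<D> \<subseteq> schur_idempotents \<D> \<and>
    (\<forall>\<Phi>\<in>hyperreflexive_idempotents \<D>. \<forall>\<Psi>\<in>hyperreflexive_idempotents \<D>.
      schur_meet \<Phi> \<Psi> \<in> hyperreflexive_idempotents \<D> \<and>
      schur_join \<Phi> \<Psi> \<in> hyperreflexive_idempotents \<D>)"
  using schur_meet_hyperreflexive[OF masa] schur_join_hyperreflexive[OF masa]
    hyperreflexive_idempotentsD(1)
  by blast

end
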